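(* If $G$ is a finite connected unicyclic graph, then $D'(G) = D(G)$.
   Context: A unicyclic graph is a graph containing exactly one cycle. $D(G)$ (the distinguishing number) is the least number $r$ of labels in a vertex labeling $V(G)\to\{1,\dots,r\}$ preserved by no non-identity automorphism of $G$; $D'(G)$ (the distinguishing index) is the least number of labels in an edge labeling preserved by no non-identity automorphism of $G$. *)

theory Defs
  imports "HOL-Library.FuncSet"
begin

definition finite_simple_graph :: "'a set \<Rightarrow> 'a set set \<Rightarrow> bool" where
  "finite_simple_graph V E \<longleftrightarrow>
     finite V \<and> E \<subseteq> {{u, v} | u v. u \<in> V \<and> v \<in> V \<and> u \<noteq> v}"

definition walk :: "'a set \<Rightarrow> 'a set set \<Rightarrow> 'a list \<Rightarrow> bool" where
  "walk V E p \<longleftrightarrow> p \<noteq> [] \<and> set p \<subseteq> V \<and> successively (\<lambda>u v. {u, v} \<in> E) p"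

definition connected_graph :: "'a set \<Rightarrow> 'a set set \<Rightarrow> bool" where
  "connected_graph V E \<longleftrightarrow>
     V \<noteq> {} \<and> (\<forall>u\<in>V. \<forall>v\<in>V. \<exists>p. walk V E p \<and> hd p = u \<and> last p = v)"

definition cyclic_edges :: "'a list \<Rightarrow> 'a set set" where
  "cyclic_edges xs = {{xs ! i, xs ! (Suc i mod length xs)} | i. i < length xs}"

text \<open>
  A cycle is a subgraph. It is represented by its edge set, which determines it, so that the
  different starting points and orientations of a cyclic vertex sequence count only once.
\<close>

definition is_cycle :: "'a set \<Rightarrow> 'a set set \<Rightarrow> 'a set set \<Rightarrow> bool" where
  "is_cycle V E C \<longleftrightarrow>
     (\<exists>xs. 3 \<le> length xs \<and> distinct xs \<and> set xs \<subseteq> V \<and> C = cyclic_edges xs \<and> C \<subseteq> E)"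

definition unicyclic :: "'a set \<Rightarrow> 'a set set \<Rightarrow> bool" where
  "unicyclic V E \<longleftrightarrow> (\<exists>!C. is_cycle V E C)"

text \<open>
  Only the values of an automorphism on \<^term>\<open>V\<close> matter; accordingly, being the identity
  means \<^prop>\<open>\<forall>v\<in>V. f v = v\<close>.
\<close>

definition automorphism :: "'a set \<Rightarrow> 'a set set \<Rightarrow> ('a \<Rightarrow> 'a) \<Rightarrow> bool" where
  "automorphism V E f \<longleftrightarrow>
     bij_betw f V V \<and> (\<forall>u\<in>V. \<forall>v\<in>V. {f u, f v} \<in> E \<longleftrightarrow> {u, v} \<in> E)"

definition distinguishing_vertex_labeling ::
    "'a set \<Rightarrow> 'a set set \<Rightarrow> ('a \<Rightarrow> nat) \<Rightarrow> bool" where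
  "distinguishing_vertex_labeling V E c \<longleftrightarrow>
     (\<forall>f. automorphism V E f \<and> (\<forall>v\<in>V. c (f v) = c v) \<longrightarrow> (\<forall>v\<in>V. f v = v))"

definition distinguishing_edge_labeling ::
    "'a set \<Rightarrow> 'a set set \<Rightarrow> ('a set \<Rightarrow> nat) \<Rightarrow> bool" where
  "distinguishing_edge_labeling V E c \<longleftrightarrow>
     (\<forall>f. automorphism V E f \<and> (\<forall>e\<in>E. c (f ` e) = c e) \<longrightarrow> (\<forall>v\<in>V. f v = v))"

definition distinguishing_number :: "'a set \<Rightarrow> 'a set set \<Rightarrow> nat" where
  "distinguishing_number V E =
     (LEAST r. \<exists>c \<in> V \<rightarrow> {1..r}. distinguishing_vertex_labeling V E c)"

text \<open>
  The distinguishing index is meaningful only if some edge labeling is distinguishing. This fails,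
  for example, for the complete graph on two vertices, but a connected graph with a cycle always
  has such a labeling.
\<close>

definition distinguishing_index :: "'a set \<Rightarrow> 'a set set \<Rightarrow> nat" where
  "distinguishing_index V E =
     (LEAST r. \<exists>c \<in> E \<rightarrow> {1..r}. distinguishing_edge_labeling V E c)"

end

theory Submission
  imports Defs
begin

text \<open>
  Sending a vertex off the cycle to the first edge on its way to the cycle is a bijection onto the
  edges off the cycle, and it commutes with all automorphisms. So labels off the cycle can be moved
  between vertices and edges, and only the cycle needs care. There an automorphism acts as a
  rotation or a reflection of the indices modulo the length \<open>n\<close>, and it suffices to find, for
  every vertex labeling of the cycle, an edge labeling with as many labels whose dihedral symmetries
  are all symmetries of the vertex labeling. For odd \<open>n\<close> copy each vertex label to the opposite
  edge; for \<open>n \<ge> 6\<close> two labels already allow an asymmetric edge labeling; \<open>n = 4\<close> is treated by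
  hand. The converse passage is the same statement for the dual cycle.
\<close>

section \<open>Labelings of a cycle\<close>

text \<open>
  The cycle has vertices \<open>i\<close> and edges \<open>{i, i + 1}\<close> for integers \<open>i\<close> modulo \<open>n\<close>, and this edge also
  has index \<open>i\<close>. Hence the reflection of vertices \<open>i \<mapsto> k - i\<close> acts on edges by \<open>i \<mapsto> k - 1 - i\<close>.
\<close>

lemma asymmetric_three_residues:
  fixes n :: int
  assumes "n \<ge> 6" and b: "b = (\<lambda>i. if i mod n \<in> {0, 1, 3} then 2 else 1 :: nat)"
  shows "(\<forall>i. b (i + k) = b i) \<Longrightarrow> k mod n = 0" and "\<not> (\<forall>i. b (k - i) = b i)"
proof -
  have small: "x mod n = x" if "0 \<le> x" "x < n" for x
    using that by simp
  have neg: "x mod n = x + n" if "x < 0" "- n \<le> x" for x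
    using that by (metis add.commute add_less_same_cancel1 less_iff_diff_less_0 add_increasing
        diff_ge_0_iff_ge diff_minus_eq_add mod_add_self2 mod_pos_pos_trivial)
  have bi: "b i = b j" if "i mod n = j mod n" for i j
    using that by (simp add: b)
  have in_iff: "b i = 2 \<longleftrightarrow> i mod n \<in> {0, 1, 3}" for i
    by (simp add: b)
  \<comment> \<open>The cyclic gaps 1, 2 and \<open>n - 3\<close> between the marked residues are
    pairwise distinct since \<open>n \<ge> 6\<close>, so no non-trivial rotation and no reflection
    respects them. The values from -2 to 4 suffice to check this.\<close>
  have vals: "b 0 = 2" "b 1 = 2" "b 3 = 2" "b 2 \<noteq> 2" "b 4 \<noteq> 2" "b (-1) \<noteq> 2" "b (-2) \<noteq> 2"
    using assms(1) by (auto simp: in_iff small neg)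
  have red: "b (i + k) = b (i + k mod n)" "b (k - i) = b (k mod n - i)" for i
    by (auto intro!: bi simp: mod_simps)
  show "k mod n = 0" if "\<forall>i. b (i + k) = b i"
  proof -
    have "b (0 + k) = 2" "b (1 + k) = 2" "b (3 + k) = 2"
      using that vals by metis+
    then have h: "b (0 + k mod n) = 2" "b (1 + k mod n) = 2"
      using red(1) by metis+
    \<comment> \<open>The image of the marked residue 0 is marked, which leaves three values for
      \<open>k mod n\<close>; the image of 1 then excludes 1 and 3.\<close>
    then have "k mod n \<in> {0, 1, 3}"
      using in_iff by simp
    then show ?thesis
      using h vals by auto
  qed
  show "\<not> (\<forall>i. b (k - i) = b i)"
  proof
    assume "\<forall>i. b (k - i) = b i"
    then have "b (k - 0) = 2" "b (k - 1) = 2" "b (k - 3) = 2"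
      using vals by metis+
    then have h: "b (k mod n - 0) = 2" "b (k mod n - 1) = 2" "b (k mod n - 3) = 2"
      using red(2) by metis+
    then have "k mod n \<in> {0, 1, 3}"
      using in_iff by simp
    then show False
      using h vals by auto
  qed
qed

text \<open>
  With two labels every labeling of the four-cycle has a reflection symmetry, so the edge labeling
  is chosen to have a single one, which it shares with \<open>a\<close>: either fixing the vertex \<open>j\<close> (mark
  the two edges at \<open>j\<close>) or fixing the edge \<open>j\<close> (mark that edge).
\<close>

lemma four_cycle_edge_labeling:
  fixes a :: "int \<Rightarrow> nat"
  assumes per: "\<And>i. a (i mod 4) = a i" and range: "\<And>i. a i \<in> {1..r}" and r: "r \<ge> 2"
  shows "\<exists>b. (\<forall>i. b (i mod 4) = b i) \<and> (\<forall>i. b i \<in> {1..r}) \<and>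
    (\<forall>k. (\<forall>i. b (i + k) = b i) \<longrightarrow> (\<forall>i. a (i + k) = a i)) \<and>
    (\<forall>k. (\<forall>i. b (k - 1 - i) = b i) \<longrightarrow> (\<forall>i. a (k - i) = a i))"
proof -
  have a_eq: "a x = a y" if "x = y + 4 * q" for x y q
    using per[of x] per[of y] that by simp
  have trans0: "\<forall>i. a (i + k) = a i" if "k mod 4 = 0" for k
    using a_eq[of _ _ "k div 4"] that by auto
  have residue: thesis
    if "\<And>d p. i = j + d + 4 * p \<Longrightarrow> d \<in> {0, 1, 2, 3} \<Longrightarrow> thesis" for i j :: int and thesis
  proof (rule that)
    show "i = j + (i - j) mod 4 + 4 * ((i - j) div 4)"
      by (simp add: mod_mult_div_eq add.assoc)
    have "x mod 4 \<in> {0, 1, 2, 3}" for x :: int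
      by simp presburger
    then show "(i - j) mod 4 \<in> {0, 1, 2, 3}" .
  qed
  \<comment> \<open>Without a third label, either two vertices at distance two agree, and the axis
    goes through the vertex \<open>j\<close> between them, or both antipodal pairs differ.\<close>
  consider "r \<ge> 3" | j where "a (j - 1) = a (j + 1)" | "r = 2" "a 0 \<noteq> a 2" "a 1 \<noteq> a 3"
  proof -
    have "a 1 \<noteq> a 3" if "\<And>j. a (j - 1) \<noteq> a (j + 1)"
      using that[of 2] by simp
    moreover have "a 0 \<noteq> a 2" if "\<And>j. a (j - 1) \<noteq> a (j + 1)"
      using that[of 1] by simp
    moreover have "r \<ge> 3 \<or> r = 2"
      using r by linarith
    ultimately show thesis using that by blast
  qed
  then show ?thesis
  proof cases
    case 1
    \<comment> \<open>Adjacent edges with the unique labels 1 and 2 leave no symmetry: a reflection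
      would have to fix both.\<close>
    define b :: "int \<Rightarrow> nat" where
      "b i = (if i mod 4 = 0 then 1 else if i mod 4 = 1 then 2 else 3)" for i
    have b: "b i = Suc 0 \<longleftrightarrow> i mod 4 = 0" "b i = 2 \<longleftrightarrow> i mod 4 = 1" for i
      by (auto simp: b_def)
    have "k mod 4 = 0" if "\<forall>i. b (i + k) = b i" for k
      using spec[OF that, of 0] b(1)[of 0] b(1)[of k] by simp
    moreover have False if "\<forall>i. b (k - 1 - i) = b i" for k
    proof -
      have "b (k - 1 - 0) = Suc 0" "b (k - 1 - 1) = 2"
        unfolding spec[OF that] by (simp_all add: b)
      then have "(k - 1) mod 4 = 0" "(k - 2) mod 4 = 1"
        by (simp_all add: b)
      then show False by presburger
    qed
    moreover have "b (i mod 4) = b i" for i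
      by (simp add: b_def)
    moreover have "b i \<in> {1..r}" for i
      using 1 by (simp add: b_def)
    ultimately show ?thesis
      using trans0 by (intro exI[of _ b]) blast
  next
    case 2
    define b :: "int \<Rightarrow> nat" where "b i = (if (i - j) mod 4 \<in> {0, 3} then 1 else 2)" for i
    have b: "b i = Suc 0 \<longleftrightarrow> (i - j) mod 4 \<in> {0, 3}" for i
      by (simp add: b_def)
    have "k mod 4 = 0" if "\<forall>i. b (i + k) = b i" for k
    proof -
      have "b (j + k) = 1" "b (j - 1 + k) = 1"
        unfolding spec[OF that] by (simp_all add: b)
      then have "k mod 4 \<in> {0, 3}" "(k - 1) mod 4 \<in> {0, 3}"
        by (simp_all add: b algebra_simps)
      then show ?thesis by simp presburger
    qed
    moreover have "\<forall>i. a (k - i) = a i" if refl: "\<forall>i. b (k - 1 - i) = b i" for k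
    proof
      fix i
      have "b (k - 1 - j) = 1" "b (k - 1 - (j - 1)) = 1"
        unfolding spec[OF refl] by (simp_all add: b)
      \<comment> \<open>\<open>m\<close> is the offset from the reflection about vertex
        \<open>j\<close>. Both \<open>m\<close> and \<open>m - 1\<close> lie in
        \<open>{0, 3}\<close> modulo 4 only if 4 divides \<open>m\<close>, so it is that
        reflection.\<close>
      moreover define m where "m = k - 2 * j"
      moreover have "k - 1 - j - j = m - 1" "k - 1 - (j - 1) - j = m"
        by (simp_all add: m_def)
      ultimately have "m mod 4 \<in> {0, 3}" "(m - 1) mod 4 \<in> {0, 3}"
        by (simp_all add: b)
      then have "m mod 4 = 0"
        by simp presburger
      then obtain q where "m = 4 * q"
        by (metis mod_0_imp_dvd dvdE)
      then have q: "k = 2 * j + 4 * q"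
        by (simp add: m_def)
      obtain d p where i: "i = j + d + 4 * p" "d \<in> {0, 1, 2, 3}"
        by (rule residue)
      have "a i = a (j + d)" "a (k - i) = a (j - d)"
        using a_eq[of i "j + d" p] a_eq[of "k - i" "j - d" "q - p"] q i by simp_all
      \<comment> \<open>Modulo 4 the reflection fixes \<open>j\<close> and \<open>j + 2\<close> and
        swaps \<open>j - 1\<close> with \<open>j + 1\<close>, whose labels agree.\<close>
      moreover have "a (j - 2) = a (j + 2)" "a (j - 3) = a (j + 1)" "a (j + 3) = a (j - 1)"
        using a_eq[of "j - 2" "j + 2" "- 1"] a_eq[of "j - 3" "j + 1" "- 1"]
          a_eq[of "j + 3" "j - 1" 1] by simp_all
      ultimately show "a (k - i) = a i" using i(2) 2 by auto
    qed
    moreover have "b (i mod 4) = b i" for i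
      by (simp add: b_def mod_simps)
    moreover have "b i \<in> {1..r}" for i
      using r by (simp add: b_def)
    ultimately show ?thesis
      using trans0 by (intro exI[of _ b]) blast
  next
    case 3
    have two: "a i = 1 \<or> a i = 2" for i
      using range[of i] 3(1) by auto
    \<comment> \<open>Two labels with differing antipodes read 1, 1, 2, 2 around the cycle, up to
      rotation; the axis through the middle of edge \<open>j\<close> swaps equally labelled
      neighbours.\<close>
    obtain j where j: "a j = a (j + 1)" "a (j + 2) = a (j + 3)"
    proof (cases "a 0 = a 1")
      case True
      then have "a 2 = a 3" using 3 two by metis
      then show ?thesis using that[of 0] True by simp
    next
      case False
      have "a 4 = a 0" using per[of 4] by simp
      then have "a 1 = a 2" "a 3 = a 4" using False 3 two by metis+
      then show ?thesis using that[of 1] by simp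
    qed
    define b :: "int \<Rightarrow> nat" where "b i = (if (i - j) mod 4 = 0 then 1 else 2)" for i
    have b: "b i = Suc 0 \<longleftrightarrow> (i - j) mod 4 = 0" for i
      by (simp add: b_def)
    have "k mod 4 = 0" if "\<forall>i. b (i + k) = b i" for k
      using spec[OF that, of j] b[of j] b[of "j + k"] by simp
    moreover have "\<forall>i. a (k - i) = a i" if refl: "\<forall>i. b (k - 1 - i) = b i" for k
    proof
      fix i
      have "b (k - 1 - j) = 1"
        unfolding spec[OF refl] by (simp add: b)
      then have "(k - 1 - 2 * j) mod 4 = 0"
        by (simp add: b algebra_simps)
      then obtain q where "k - 1 - 2 * j = 4 * q"
        by (metis mod_0_imp_dvd dvdE)
      then have q: "k = 2 * j + 1 + 4 * q"
        by simp
      obtain d p where i: "i = j + d + 4 * p" "d \<in> {0, 1, 2, 3}"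
        by (rule residue)
      have "a i = a (j + d)" "a (k - i) = a (j + 1 - d)"
        using a_eq[of i "j + d" p] a_eq[of "k - i" "j + 1 - d" "q - p"] q i by simp_all
      moreover have "a (j - 1) = a (j + 3)" "a (j - 2) = a (j + 2)"
        using a_eq[of "j - 1" "j + 3" "- 1"] a_eq[of "j - 2" "j + 2" "- 1"] by simp_all
      ultimately show "a (k - i) = a i" using i(2) j by auto
    qed
    moreover have "b (i mod 4) = b i" for i
      by (simp add: b_def mod_simps)
    moreover have "b i \<in> {1..r}" for i
      using r by (simp add: b_def)
    ultimately show ?thesis
      using trans0 by (intro exI[of _ b]) blast
  qed
qed

text \<open>One-sided implications suffice: an automorphism preserving \<open>b\<close> then
  preserves \<open>a\<close>, so once the labels off the cycle are matched, the original
  distinguishing labeling forces the identity.\<close>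

lemma vertex_to_edge_labeling:
  fixes a :: "int \<Rightarrow> nat"
  assumes n: "n \<ge> 3" and per: "\<And>i. a (i mod n) = a i" and range: "\<And>i. a i \<in> {1..r}"
  shows "\<exists>b. (\<forall>i. b (i mod n) = b i) \<and> (\<forall>i. b i \<in> {1..r}) \<and>
    (\<forall>k. (\<forall>i. b (i + k) = b i) \<longrightarrow> (\<forall>i. a (i + k) = a i)) \<and>
    (\<forall>k. (\<forall>i. b (k - 1 - i) = b i) \<longrightarrow> (\<forall>i. a (k - i) = a i))"
proof -
  have a_cong: "a i = a j" if "i mod n = j mod n" for i j
    using per that by metis
  consider "odd n" | "r < 2" | "r \<ge> 2" "n = 4" | "r \<ge> 2" "n \<ge> 6"
  proof -
    have "odd n \<or> n = 4 \<or> n \<ge> 6" using n by presburger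
    then show thesis using that by linarith
  qed
  then show ?thesis
  proof cases
    case 1
    then obtain m where m: "n = 2 * m + 1" by (elim oddE)
    \<comment> \<open>Vertex \<open>i + 1 + m\<close> is opposite edge \<open>i\<close>: it is
      \<open>m\<close> steps away from both ends \<open>i\<close> and \<open>i + 1\<close>. This
      correspondence commutes with all symmetries.\<close>
    define b where "b i = a (i + 1 + m)" for i
    have "\<forall>i. a (i + k) = a i" if "\<forall>i. b (i + k) = b i" for k
    proof
      fix i
      show "a (i + k) = a i"
        using spec[OF that, of "i - 1 - m"] by (simp add: b_def algebra_simps)
    qed
    moreover have "\<forall>i. a (k - i) = a i" if "\<forall>i. b (k - 1 - i) = b i" for k
    proof
      fix i
      \<comment> \<open>The reflected index overshoots by \<open>2 * m + 1\<close>, one full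
        turn.\<close>
      have "a (k - i) = a (k - i + n)" by (rule a_cong) simp
      also have "\<dots> = a i"
        using spec[OF that, of "i - 1 - m"] by (simp add: b_def m algebra_simps)
      finally show "a (k - i) = a i" .
    qed
    moreover have "b (i mod n) = b i" for i
      unfolding b_def by (rule a_cong) (simp add: mod_simps add.assoc)
    moreover have "b i \<in> {1..r}" for i
      unfolding b_def by (rule range)
    ultimately show ?thesis by blast
  next
    case 2
    then have "a i = 1" for i using range[of i] by simp
    then show ?thesis using range by (intro exI[of _ a]) simp
  next
    case 3
    then show ?thesis using four_cycle_edge_labeling[of a r] per range by simp
  next
    case 4
    define b :: "int \<Rightarrow> nat" where "b = (\<lambda>i. if i mod n \<in> {0, 1, 3} then 2 else 1)"
    note asym = asymmetric_three_residues[OF 4(2) b_def]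
    have "\<forall>i. a (i + k) = a i" if "\<forall>i. b (i + k) = b i" for k
    proof
      fix i
      have "k mod n = 0" using asym(1) that .
      then show "a (i + k) = a i" by (intro a_cong) (simp add: mod_add_eq[symmetric])
    qed
    moreover have "b (i mod n) = b i" for i
      by (simp add: b_def)
    moreover have "b i \<in> {1..r}" for i
      using 4 by (simp add: b_def)
    ultimately show ?thesis using asym(2) by blast
  qed
qed

text \<open>The previous lemma is applied to the dual cycle, whose vertices are the edges. The edge
  joining dual vertices \<open>i\<close> and \<open>i + 1\<close> is the vertex
  \<open>i + 1\<close>, whence the shift in \<open>a\<close>.\<close>

lemma edge_to_vertex_labeling:
  fixes b :: "int \<Rightarrow> nat"
  assumes n: "n \<ge> 3" and per: "\<And>i. b (i mod n) = b i" and range: "\<And>i. b i \<in> {1..r}"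
  shows "\<exists>a. (\<forall>i. a (i mod n) = a i) \<and> (\<forall>i. a i \<in> {1..r}) \<and>
    (\<forall>k. (\<forall>i. a (i + k) = a i) \<longrightarrow> (\<forall>i. b (i + k) = b i)) \<and>
    (\<forall>k. (\<forall>i. a (k - i) = a i) \<longrightarrow> (\<forall>i. b (k - 1 - i) = b i))"
proof -
  obtain c where c: "\<And>i. c (i mod n) = c i" "\<And>i. c i \<in> {1..r}"
    "\<And>k. (\<forall>i. c (i + k) = c i) \<Longrightarrow> (\<forall>i. b (i + k) = b i)"
    "\<And>k. (\<forall>i. c (k - 1 - i) = c i) \<Longrightarrow> (\<forall>i. b (k - i) = b i)"
    using vertex_to_edge_labeling[OF n, of b r] per range by auto
  define a where "a i = c (i - 1)" for i
  have "\<forall>i. b (i + k) = b i" if "\<forall>i. a (i + k) = a i" for k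
  proof -
    have "c (i + k) = c i" for i
      using spec[OF that, of "i + 1"] by (simp add: a_def algebra_simps)
    then show ?thesis using c(3) by blast
  qed
  moreover have "\<forall>i. b (k - 1 - i) = b i" if "\<forall>i. a (k - i) = a i" for k
  proof -
    have "c (k - 1 - 1 - i) = c i" for i
      using spec[OF that, of "i + 1"] by (simp add: a_def algebra_simps)
    then show ?thesis using c(4) by blast
  qed
  moreover have "a (i mod n) = a i" for i
    using c(1)[of "i mod n - 1"] c(1)[of "i - 1"] by (simp add: a_def mod_simps)
  moreover have "a i \<in> {1..r}" for i
    unfolding a_def by (rule c(2))
  ultimately show ?thesis by blast
qed

section \<open>Cyclic vertex sequences and paths\<close>

text \<open>Integer indices read modulo the length turn rotations and reflections into plain
  addition and subtraction.\<close>

definition cyc_nth :: "'a list \<Rightarrow> int \<Rightarrow> 'a" where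
  "cyc_nth xs i = xs ! nat (i mod int (length xs))"

lemma cyc_nth_eq_iff:
  assumes "distinct xs" and "xs \<noteq> []"
  shows "cyc_nth xs i = cyc_nth xs j \<longleftrightarrow> i mod int (length xs) = j mod int (length xs)"
proof -
  have "nat (i mod int (length xs)) < length xs" for i
    using assms(2) by (simp add: nat_less_iff)
  then show ?thesis
    using assms by (simp add: cyc_nth_def nth_eq_iff_index_eq eq_nat_nat_iff)
qed

lemma cyc_nth_int: "i < length xs \<Longrightarrow> cyc_nth xs (int i) = xs ! i"
  by (simp add: cyc_nth_def)

lemma cyc_nth_Suc_mod: "xs \<noteq> [] \<Longrightarrow> cyc_nth xs (int i + 1) = xs ! (Suc i mod length xs)"
  by (simp add: cyc_nth_def nat_mod_distrib nat_add_distrib)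

lemma cyc_nth_mod: "cyc_nth xs (i mod int (length xs)) = cyc_nth xs i"
  by (simp add: cyc_nth_def)

text \<open>One list position \<open>j\<close> serves all offsets \<open>k\<close>, so a vertex and
  its successor are brought into the range of the list together.\<close>

lemma ex_index_cyc_nth:
  assumes "xs \<noteq> []"
  obtains j where "j < length xs" and "\<And>k. cyc_nth xs (i + k) = cyc_nth xs (int j + k)"
proof
  show "nat (i mod int (length xs)) < length xs"
    using assms by (simp add: nat_less_iff)
  show "cyc_nth xs (i + k) = cyc_nth xs (int (nat (i mod int (length xs))) + k)" for k
    using assms by (simp add: cyc_nth_def mod_simps)
qed

lemma set_eq_range_cyc_nth:
  assumes "xs \<noteq> []"
  shows "set xs = range (cyc_nth xs)"
proof
  show "set xs \<subseteq> range (cyc_nth xs)"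
    by (metis cyc_nth_int in_set_conv_nth range_eqI subsetI)
  show "range (cyc_nth xs) \<subseteq> set xs"
  proof clarify
    fix i
    obtain j where "j < length xs" "cyc_nth xs (i + 0) = cyc_nth xs (int j + 0)"
      using ex_index_cyc_nth[OF assms] by metis
    then show "cyc_nth xs i \<in> set xs" by (simp add: cyc_nth_int)
  qed
qed

lemma cyclic_edges_eq_range:
  assumes "xs \<noteq> []"
  shows "cyclic_edges xs = range (\<lambda>i. {cyc_nth xs i, cyc_nth xs (i + 1)})"
proof
  show "cyclic_edges xs \<subseteq> range (\<lambda>i. {cyc_nth xs i, cyc_nth xs (i + 1)})"
  proof
    fix e assume "e \<in> cyclic_edges xs"
    then obtain i where "i < length xs" "e = {xs ! i, xs ! (Suc i mod length xs)}"
      by (auto simp: cyclic_edges_def)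
    then have "e = {cyc_nth xs (int i), cyc_nth xs (int i + 1)}"
      using assms by (simp add: cyc_nth_int cyc_nth_Suc_mod)
    then show "e \<in> range (\<lambda>i. {cyc_nth xs i, cyc_nth xs (i + 1)})" by blast
  qed
  show "range (\<lambda>i. {cyc_nth xs i, cyc_nth xs (i + 1)}) \<subseteq> cyclic_edges xs"
  proof clarify
    fix i
    obtain j where j: "j < length xs" "\<And>k. cyc_nth xs (i + k) = cyc_nth xs (int j + k)"
      using ex_index_cyc_nth[OF assms] by metis
    have "cyc_nth xs i = xs ! j" "cyc_nth xs (i + 1) = xs ! (Suc j mod length xs)"
      using j(1) j(2)[of 0] j(2)[of 1] assms by (simp_all add: cyc_nth_int cyc_nth_Suc_mod)
    then show "{cyc_nth xs i, cyc_nth xs (i + 1)} \<in> cyclic_edges xs"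
      using j(1) by (auto simp: cyclic_edges_def)
  qed
qed

lemma cyclic_edges_eq_image:
  "cyclic_edges xs = (\<lambda>i. {xs ! i, xs ! (Suc i mod length xs)}) ` {..<length xs}"
  by (auto simp: cyclic_edges_def)

lemma cyclic_edges_map: "cyclic_edges (map f xs) = (`) f ` cyclic_edges xs"
proof -
  have lt: "Suc i mod length xs < length xs" if "i < length xs" for i
    using that by (intro mod_less_divisor) linarith
  show ?thesis
    unfolding cyclic_edges_eq_image image_image length_map
    by (rule image_cong) (use lt in auto)
qed

lemma Union_cyclic_edges: "xs \<noteq> [] \<Longrightarrow> \<Union> (cyclic_edges xs) = set xs"
  unfolding cyclic_edges_eq_range set_eq_range_cyc_nth
  by auto

section \<open>Reachability and simple paths\<close>

definition adj :: "'a set set \<Rightarrow> ('a \<times> 'a) set" where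
  "adj F = {(x, y). {x, y} \<in> F}"

lemma adj_iff: "(x, y) \<in> adj F \<longleftrightarrow> {x, y} \<in> F"
  by (simp add: adj_def)

lemma adj_mono: "F \<subseteq> F' \<Longrightarrow> adj F \<subseteq> adj F'"
  by (auto simp: adj_def)

lemma adj_rtrancl_sym: "(x, y) \<in> (adj F)\<^sup>* \<Longrightarrow> (y, x) \<in> (adj F)\<^sup>*"
  by (rule symD[OF sym_rtrancl]) (auto simp: sym_def adj_iff insert_commute)

lemma successively_rtrancl:
  "successively R p \<Longrightarrow> p \<noteq> [] \<Longrightarrow> (hd p, last p) \<in> {(x, y). R x y}\<^sup>*"
proof (induction p)
  case (Cons x p)
  then show ?case
    by (cases p) (auto intro: converse_rtrancl_into_rtrancl)
qed simp

lemma rtrancl_distinct_path: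
  assumes "(x, y) \<in> r\<^sup>*"
  obtains p where "p \<noteq> []" "hd p = x" "last p = y" "distinct p" "successively (\<lambda>u v. (u, v) \<in> r) p"
proof -
  have "\<exists>p. p \<noteq> [] \<and> hd p = x \<and> last p = y \<and> distinct p \<and> successively (\<lambda>u v. (u, v) \<in> r) p"
    using assms
  proof (induction rule: converse_rtrancl_induct)
    case base
    show ?case by (intro exI[of _ "[y]"]) simp
  next
    case (step u w)
    then obtain p where p: "p \<noteq> []" "hd p = w" "last p = y" "distinct p"
      "successively (\<lambda>u v. (u, v) \<in> r) p" by blast
    show ?case
    proof (cases "u \<in> set p")
      case True
      \<comment> \<open>A repeated vertex is handled by discarding everything before it; the tail is
        already a distinct path from \<open>u\<close>.\<close>
      then obtain p1 p2 where "p = p1 @ u # p2" by (meson split_list)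
      with p show ?thesis
        by (intro exI[of _ "u # p2"]) (auto simp: successively_append_iff)
    next
      case False
      with p step(1) show ?thesis
        by (intro exI[of _ "u # p"]) (auto simp: successively_Cons)
    qed
  qed
  then show thesis using that by blast
qed

lemma automorphism_inv_into:
  assumes "automorphism V E f"
  shows "automorphism V E (inv_into V f)"
proof -
  have f: "bij_betw f V V" "\<And>u v. u \<in> V \<Longrightarrow> v \<in> V \<Longrightarrow> {f u, f v} \<in> E \<longleftrightarrow> {u, v} \<in> E"
    using assms by (auto simp: automorphism_def)
  have g: "bij_betw (inv_into V f) V V"
    using f(1) by (rule bij_betw_inv_into)
  have "{inv_into V f u, inv_into V f v} \<in> E \<longleftrightarrow> {u, v} \<in> E" if "u \<in> V" "v \<in> V" for u v
    using f(2)[of "inv_into V f u" "inv_into V f v"] that f(1) g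
    by (simp add: bij_betw_inv_into_right bij_betw_apply)
  with g show ?thesis by (simp add: automorphism_def)
qed

section \<open>Connected unicyclic graphs\<close>

text \<open>Fixing a vertex sequence \<open>xs\<close> of the cycle supplies a base point and an
  orientation for indexing; \<open>cycle_unique\<close> still speaks of edge sets, so the choice is
  harmless.\<close>

locale unicyclic_graph =
  fixes V :: "'a set" and E :: "'a set set" and xs :: "'a list"
  assumes simple: "finite_simple_graph V E"
    and conn: "connected_graph V E"
    and length_xs: "3 \<le> length xs"
    and distinct_xs: "distinct xs"
    and xs_V: "set xs \<subseteq> V"
    and cycle_E: "cyclic_edges xs \<subseteq> E"
    and cycle_unique: "is_cycle V E C \<Longrightarrow> C = cyclic_edges xs"
begin

section \<open>Integer indexing of the cycle\<close>

abbreviation "n \<equiv> int (length xs)"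

abbreviation "v \<equiv> cyc_nth xs"

definition "cyc_edge i = {v i, v (i + 1)}"

lemma xs_nonempty: "xs \<noteq> []"
  using length_xs by auto

lemma v_eq_iff: "v i = v j \<longleftrightarrow> i mod n = j mod n"
  by (rule cyc_nth_eq_iff[OF distinct_xs xs_nonempty])

lemma v_add_cong: "v i = v j \<Longrightarrow> v (i + k) = v (j + k)"
  unfolding v_eq_iff by (rule mod_add_cong) simp_all

lemma set_xs: "set xs = range v"
  by (rule set_eq_range_cyc_nth[OF xs_nonempty])

lemma cyclic_edges_xs: "cyclic_edges xs = range cyc_edge"
  unfolding cyclic_edges_eq_range[OF xs_nonempty] cyc_edge_def ..

text \<open>Length at least 3 makes the two neighbours of a cycle vertex distinct; this fixes edge
  indices and keeps an automorphism from folding the cycle.\<close>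

lemma v_neq_add2: "v i \<noteq> v (i + 2)"
proof
  assume "v i = v (i + 2)"
  then have "v (i - i) = v (i + 2 - i)"
    using v_add_cong[of i "i + 2" "- i"] by simp
  then have "(0 :: int) mod n = 2 mod n"
    unfolding v_eq_iff[symmetric] by simp
  then show False using length_xs by simp
qed

lemma cyc_edge_eq_iff: "cyc_edge i = cyc_edge j \<longleftrightarrow> i mod n = j mod n"
proof
  assume "cyc_edge i = cyc_edge j"
  then consider "v i = v j" | "v i = v (j + 1)" "v (i + 1) = v j"
    by (auto simp: cyc_edge_def doubleton_eq_iff)
  then show "i mod n = j mod n"
  proof cases
    \<comment> \<open>Matching the ends crosswise would make vertices two apart coincide.\<close>
    case 2
    then have "v j = v (j + 2)"
      using v_add_cong[of i "j + 1" 1] by (simp add: add.assoc)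
    then show ?thesis using v_neq_add2 by blast
  qed (simp add: v_eq_iff)
next
  assume "i mod n = j mod n"
  then have "v i = v j" by (simp add: v_eq_iff)
  then show "cyc_edge i = cyc_edge j"
    using v_add_cong[of i j 1] by (simp add: cyc_edge_def)
qed

lemma cyc_neighbour:
  assumes "{v i, v j} \<in> cyclic_edges xs"
  shows "v j = v (i + 1) \<or> v j = v (i - 1)"
proof -
  obtain k where "{v i, v j} = {v k, v (k + 1)}"
    using assms by (auto simp: cyclic_edges_xs cyc_edge_def)
  then consider "v i = v k" "v j = v (k + 1)" | "v i = v (k + 1)" "v j = v k"
    by (auto simp: doubleton_eq_iff)
  then show ?thesis
  proof cases
    case 1
    then show ?thesis using v_add_cong[of i k 1] by simp
  next
    case 2
    then show ?thesis using v_add_cong[of i "k + 1" "-1"] by simp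
  qed
qed

lemma edge_V: "{x, y} \<in> E \<Longrightarrow> x \<in> V \<and> y \<in> V \<and> x \<noteq> y"
  using simple unfolding finite_simple_graph_def by (auto simp: doubleton_eq_iff)

lemma edge_obtain:
  assumes "e \<in> E"
  obtains x y where "e = {x, y}" "x \<in> V" "y \<in> V" "x \<noteq> y"
  using assms simple unfolding finite_simple_graph_def by blast

lemma cyc_edge_subset: "e \<in> cyclic_edges xs \<Longrightarrow> e \<subseteq> set xs"
  using Union_cyclic_edges[OF xs_nonempty] by blast

section \<open>Automorphisms on the cycle\<close>

lemma automorphism_cycle:
  assumes "automorphism V E f"
  shows "(`) f ` cyclic_edges xs = cyclic_edges xs"
proof -
  have f: "bij_betw f V V" "\<And>u v. u \<in> V \<Longrightarrow> v \<in> V \<Longrightarrow> {f u, f v} \<in> E \<longleftrightarrow> {u, v} \<in> E"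
    using assms by (auto simp: automorphism_def)
  have "distinct (map f xs)"
    using f(1) xs_V distinct_xs by (metis bij_betw_def distinct_map inj_on_subset)
  moreover have "set (map f xs) \<subseteq> V"
    using f(1) xs_V by (auto dest: bij_betwE)
  moreover have "cyclic_edges (map f xs) \<subseteq> E"
  proof -
    have "f ` e \<in> E" if "e \<in> cyclic_edges xs" for e
    proof -
      have "e \<in> E" using that cycle_E by blast
      then obtain x y where "e = {x, y}" "x \<in> V" "y \<in> V" by (rule edge_obtain)
      with \<open>e \<in> E\<close> f(2) show ?thesis by simp
    qed
    then show ?thesis unfolding cyclic_edges_map by blast
  qed
  \<comment> \<open>The image of the cycle is again a cycle, and there is only one.\<close>
  ultimately have "is_cycle V E (cyclic_edges (map f xs))"
    using length_xs unfolding is_cycle_def by (metis length_map)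
  then show ?thesis
    using cycle_unique unfolding cyclic_edges_map by blast
qed

lemma automorphism_cycle_vertices:
  assumes "automorphism V E f"
  shows "f ` set xs = set xs"
proof -
  have "f ` \<Union> (cyclic_edges xs) = \<Union> ((`) f ` cyclic_edges xs)" by blast
  then show ?thesis
    by (simp add: automorphism_cycle[OF assms] Union_cyclic_edges[OF xs_nonempty])
qed

text \<open>The images of two adjacent vertices give a start \<open>k\<close> and a direction
  \<open>s\<close>; injectivity forbids turning back, so all further images are forced.\<close>

lemma automorphism_dihedral:
  assumes "automorphism V E f"
  shows "(\<exists>k. \<forall>i. f (v i) = v (i + k)) \<or> (\<exists>k. \<forall>i. f (v i) = v (k - i))"
proof -
  have inj: "f (v i) = f (v j) \<Longrightarrow> v i = v j" for i j
    using assms xs_V set_xs by (auto simp: automorphism_def dest!: bij_betw_imp_inj_on inj_onD)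
  have step: "{f (v i), f (v (i + 1))} \<in> cyclic_edges xs" for i
  proof -
    have "f ` cyc_edge i \<in> (`) f ` cyclic_edges xs"
      unfolding cyclic_edges_xs by blast
    then show ?thesis
      unfolding automorphism_cycle[OF assms] by (simp add: cyc_edge_def)
  qed
  have on_cycle: "\<exists>j. f (v i) = v j" for i
    using automorphism_cycle_vertices[OF assms] set_xs by blast
  obtain k where k: "f (v 0) = v k" using on_cycle by blast
  obtain l where l: "f (v 1) = v l" using on_cycle by blast
  have "v l = v (k + 1) \<or> v l = v (k - 1)"
    using cyc_neighbour[of k l] step[of 0] k l by simp
  then obtain s :: int where s: "s = 1 \<or> s = -1" "f (v 1) = v (k + s)"
    using l by (metis add_uminus_conv_diff)
  \<comment> \<open>Carrying two consecutive images through the induction is what excludes the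
    backward neighbour at the next step.\<close>
  have nat: "f (v (int m)) = v (k + s * int m) \<and> f (v (int m + 1)) = v (k + s * (int m + 1))" for m
  proof (induction m)
    case 0
    show ?case using k s by simp
  next
    case (Suc m)
    obtain j where j: "f (v (int m + 2)) = v j" using on_cycle by blast
    have "{v (k + s * (int m + 1)), v j} \<in> cyclic_edges xs"
      using step[of "int m + 1"] Suc j by (simp add: add.assoc)
    then have "v j = v (k + s * (int m + 1) + 1) \<or> v j = v (k + s * (int m + 1) - 1)"
      by (rule cyc_neighbour)
    moreover have "v j \<noteq> v (k + s * int m)"
      using inj[of "int m" "int m + 2"] Suc j v_neq_add2[of "int m"] by metis
    ultimately have "v j = v (k + s * (int m + 2))"
      using s(1) by (auto simp: algebra_simps)
    then show ?case
      using Suc j by (simp add: algebra_simps)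
  qed
  have all: "f (v i) = v (k + s * i)" for i
  proof -
    define m where "m = nat (i mod n)"
    have m: "int m = i mod n"
      using xs_nonempty by (simp add: m_def)
    have "f (v i) = v (k + s * int m)"
      using nat[of m] m by (simp add: cyc_nth_mod)
    also have "\<dots> = v (k + s * i)"
      unfolding v_eq_iff m by (metis mod_add_right_eq mod_mult_right_eq)
    finally show ?thesis .
  qed
  show ?thesis
  proof (cases "s = 1")
    case True
    then have "\<forall>i. f (v i) = v (i + k)" using all by (simp add: add.commute)
    then show ?thesis by blast
  next
    case False
    then have "\<forall>i. f (v i) = v (k - i)" using all s(1) by simp
    then show ?thesis by blast
  qed
qed

section \<open>Distance to the cycle\<close>

definition depth :: "'a \<Rightarrow> nat" where
  "depth x = (LEAST m. \<exists>c\<in>set xs. (c, x) \<in> adj E ^^ m)"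

lemma depth_witness:
  assumes "x \<in> V"
  shows "\<exists>c\<in>set xs. (c, x) \<in> adj E ^^ depth x"
proof -
  obtain c where c: "c \<in> set xs"
    using xs_nonempty by (meson hd_in_set)
  then obtain p where p: "walk V E p" "hd p = c" "last p = x"
    using conn assms xs_V unfolding connected_graph_def by blast
  then have "(hd p, last p) \<in> (adj E)\<^sup>*"
    unfolding adj_def walk_def by (intro successively_rtrancl) simp_all
  then obtain m where "(c, x) \<in> adj E ^^ m"
    using p rtrancl_imp_relpow by blast
  then have "\<exists>c\<in>set xs. (c, x) \<in> adj E ^^ m"
    using c by blast
  then show ?thesis
    unfolding depth_def by (rule LeastI)
qed

lemma depth_le: "c \<in> set xs \<Longrightarrow> (c, x) \<in> adj E ^^ m \<Longrightarrow> depth x \<le> m"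
  unfolding depth_def by (rule Least_le) blast

lemma depth_eq_0_iff: "x \<in> V \<Longrightarrow> depth x = 0 \<longleftrightarrow> x \<in> set xs"
  using depth_witness[of x] depth_le[of x x 0] by auto

lemma depth_edge:
  assumes "{x, y} \<in> E"
  shows "depth y \<le> Suc (depth x)"
proof -
  obtain c where "c \<in> set xs" "(c, x) \<in> adj E ^^ depth x"
    using depth_witness edge_V assms by blast
  then show ?thesis
    using assms by (intro depth_le) (auto simp: adj_iff)
qed

lemma ex_parent:
  assumes "x \<in> V - set xs"
  shows "\<exists>y. {x, y} \<in> E \<and> depth x = Suc (depth y)"
proof -
  obtain m where m: "depth x = Suc m"
    using assms depth_eq_0_iff[of x] by (cases "depth x") auto
  obtain c where c: "c \<in> set xs" "(c, x) \<in> adj E ^^ depth x"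
    using depth_witness assms by blast
  then obtain y where y: "(c, y) \<in> adj E ^^ m" "{y, x} \<in> E"
    unfolding m by (auto simp: adj_iff)
  then have "depth y \<le> m" "depth x \<le> Suc (depth y)"
    using depth_le c(1) depth_edge by blast+
  then show ?thesis
    using y(2) m by (intro exI[of _ y]) (auto simp: insert_commute)
qed

lemma adj_relpow_automorphism:
  assumes "automorphism V E f"
  shows "(x, y) \<in> adj E ^^ m \<Longrightarrow> (f x, f y) \<in> adj E ^^ m"
proof (induction m arbitrary: y)
  case (Suc m)
  then obtain z where z: "(x, z) \<in> adj E ^^ m" "{z, y} \<in> E"
    by (auto simp: adj_iff)
  then have "{f z, f y} \<in> E"
    using assms edge_V by (auto simp: automorphism_def)
  then show ?case using Suc.IH[OF z(1)] by (auto simp: adj_iff)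
qed simp

text \<open>Automorphisms carry walks starting on the cycle to walks starting on the cycle; the
  reverse inequality then follows from the inverse automorphism.\<close>

lemma depth_automorphism_le:
  assumes "automorphism V E f" and "x \<in> V"
  shows "depth (f x) \<le> depth x"
proof -
  obtain c where "c \<in> set xs" "(c, x) \<in> adj E ^^ depth x"
    using depth_witness assms by blast
  then show ?thesis
    using adj_relpow_automorphism[OF assms(1)] automorphism_cycle_vertices[OF assms(1)]
    by (intro depth_le[of "f c"]) auto
qed

lemma depth_automorphism:
  assumes "automorphism V E f" and "x \<in> V"
  shows "depth (f x) = depth x"
proof (rule antisym)
  have f: "bij_betw f V V" using assms by (simp add: automorphism_def)
  have "depth (inv_into V f (f x)) \<le> depth (f x)"
    using depth_automorphism_le[OF automorphism_inv_into[OF assms(1)]] f assms(2)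
    by (simp add: bij_betw_apply)
  then show "depth x \<le> depth (f x)"
    using f assms(2) by (simp add: bij_betw_inv_into_left)
qed (rule depth_automorphism_le[OF assms])

section \<open>Bridges and descents to the cycle\<close>

lemma non_cycle_edge_bridge:
  assumes e: "{x, y} \<in> E" "{x, y} \<notin> cyclic_edges xs"
  shows "(x, y) \<notin> (adj (E - {{x, y}}))\<^sup>*"
proof
  assume "(x, y) \<in> (adj (E - {{x, y}}))\<^sup>*"
  then obtain p where p: "p \<noteq> []" "hd p = x" "last p = y" "distinct p"
    "successively (\<lambda>u v. (u, v) \<in> adj (E - {{x, y}})) p"
    by (rule rtrancl_distinct_path)
  have steps: "{p ! i, p ! Suc i} \<in> E - {{x, y}}" if "Suc i < length p" for i
    using p(5) that unfolding successively_conv_nth by (simp add: adj_iff)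
  have ends: "p ! 0 = x" "p ! (length p - 1) = y"
    using p by (auto simp: hd_conv_nth last_conv_nth)
  \<comment> \<open>Length 1 would identify the ends of the edge; length 2 would use the removed
    edge.\<close>
  have "length p \<noteq> 1" "length p \<noteq> 2"
    using ends steps[of 0] edge_V[OF e(1)] by auto
  then have len: "length p \<ge> 3"
    using p(1) by (cases p) (auto simp: neq_Nil_conv Suc_le_eq less_Suc_eq_le not_less numeral_eq_Suc)
  \<comment> \<open>Closing the path with the removed edge yields a cycle through
    \<open>{x, y}\<close>, which therefore differs from the given one.\<close>
  have closing: "{p ! i, p ! (Suc i mod length p)} = {x, y}" if "i = length p - 1" for i
  proof -
    have "Suc i = length p" using that len by simp
    then show ?thesis using that ends by (auto simp: insert_commute)
  qed
  have in_E: "{p ! i, p ! (Suc i mod length p)} \<in> E" if "i < length p" for i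
  proof (cases "Suc i < length p")
    case True
    then show ?thesis using steps by simp
  next
    case False
    then have "i = length p - 1" using that by simp
    then show ?thesis using closing e(1) by metis
  qed
  then have "set p \<subseteq> V"
    using edge_V by (metis in_set_conv_nth subsetI)
  moreover have "cyclic_edges p \<subseteq> E"
    using in_E by (auto simp: cyclic_edges_def)
  ultimately have "is_cycle V E (cyclic_edges p)"
    using len p(4) unfolding is_cycle_def by blast
  moreover have "{x, y} \<in> cyclic_edges p"
    using closing[of "length p - 1"] p(1) unfolding cyclic_edges_def
    by (metis (mono_tags, lifting) diff_less length_greater_0_conv mem_Collect_eq zero_less_one)
  ultimately show False
    using cycle_unique e(2) by blast
qed

text \<open>
  An edge off the cycle is a bridge, and descents to the cycle along depth-decreasing edges avoid
  every edge that would offer a second way down; this makes the parent of a vertex unique.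
\<close>

definition descending_edges :: "nat \<Rightarrow> 'a set set" where
  "descending_edges d = {{x, y} | x y. {x, y} \<in> E \<and> depth x = Suc (depth y) \<and> depth x \<le> d}"

text \<open>The bound \<open>d\<close> stays fixed while the depth falls, so the whole induction
  stays within one edge set.\<close>

lemma descent_to_cycle:
  "x \<in> V \<Longrightarrow> depth x \<le> d \<Longrightarrow> \<exists>c\<in>set xs. (x, c) \<in> (adj (descending_edges d))\<^sup>*"
proof (induction "depth x" arbitrary: x)
  case 0
  then show ?case using depth_eq_0_iff by auto
next
  case (Suc m)
  then have "x \<in> V - set xs" using depth_eq_0_iff[of x] by simp
  then obtain y where y: "{x, y} \<in> E" "depth x = Suc (depth y)"
    using ex_parent by blast
  then obtain c where "c \<in> set xs" "(y, c) \<in> (adj (descending_edges d))\<^sup>*"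
    using Suc.hyps(1)[of y] Suc.hyps(2) Suc.prems edge_V[OF y(1)] by auto
  moreover have "(x, y) \<in> adj (descending_edges d)"
    using y Suc.prems unfolding adj_iff descending_edges_def by blast
  ultimately show ?case by (blast intro: converse_rtrancl_into_rtrancl)
qed

lemma cycle_connected:
  assumes "c \<in> set xs" and "c' \<in> set xs"
  shows "(c, c') \<in> (adj (cyclic_edges xs))\<^sup>*"
proof -
  obtain i j where ij: "c = v i" "c' = v j"
    using assms set_xs by blast
  have "(v i, v (i + int m)) \<in> (adj (cyclic_edges xs))\<^sup>*" for m
  proof (induction m)
    case (Suc m)
    have "(v (i + int m), v (i + int m + 1)) \<in> adj (cyclic_edges xs)"
      by (auto simp: adj_iff cyclic_edges_xs cyc_edge_def)
    with Suc have "(v i, v (i + int m + 1)) \<in> (adj (cyclic_edges xs))\<^sup>*"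
      by (rule rtrancl_into_rtrancl)
    then show ?case by (simp add: algebra_simps)
  qed simp
  \<comment> \<open>Walking forward far enough reaches every cycle vertex, so one direction
    suffices.\<close>
  moreover have "v (i + int (nat ((j - i) mod n))) = v j"
    using xs_nonempty unfolding v_eq_iff by (simp add: mod_simps)
  ultimately show ?thesis
    using ij by metis
qed

text \<open>Descend from both vertices to the cycle and join the two ends along it; \<open>e\<close>
  lies on none of the three pieces.\<close>

lemma connected_by_descents:
  assumes "x \<in> V" "y \<in> V" and e: "e \<notin> cyclic_edges xs"
    and "e \<notin> descending_edges (depth x)" "e \<notin> descending_edges (depth y)"
  shows "(x, y) \<in> (adj (E - {e}))\<^sup>*"
proof -
  have desc: "\<exists>c\<in>set xs. (z, c) \<in> (adj (E - {e}))\<^sup>*"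
    if "z \<in> V" "e \<notin> descending_edges (depth z)" for z
  proof -
    have "descending_edges (depth z) \<subseteq> E - {e}"
      using that by (auto simp: descending_edges_def)
    then show ?thesis
      using descent_to_cycle[of z "depth z"] that rtrancl_mono[OF adj_mono] by blast
  qed
  obtain c c' where c: "c \<in> set xs" "c' \<in> set xs"
    and "(x, c) \<in> (adj (E - {e}))\<^sup>*" "(y, c') \<in> (adj (E - {e}))\<^sup>*"
    using desc assms by meson
  moreover have "(c, c') \<in> (adj (E - {e}))\<^sup>*"
    using cycle_connected[OF c] rtrancl_mono[OF adj_mono[of "cyclic_edges xs" "E - {e}"]]
      cycle_E e by blast
  ultimately show ?thesis
    by (meson adj_rtrancl_sym rtrancl_trans)
qed

text \<open>Descents never use an edge between equal depths, so its ends would stay connected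
  without it, although it is a bridge.\<close>

lemma non_cycle_edge_depth_neq:
  assumes "{x, y} \<in> E" "{x, y} \<notin> cyclic_edges xs"
  shows "depth x \<noteq> depth y"
proof
  assume "depth x = depth y"
  then have "{x, y} \<notin> descending_edges d" for d
    by (auto simp: descending_edges_def doubleton_eq_iff)
  then show False
    using connected_by_descents[of x y "{x, y}"] non_cycle_edge_bridge assms edge_V by blast
qed

text \<open>With two parents, \<open>x\<close> would still reach \<open>y\<close> through
  \<open>y'\<close> after removal of the bridge \<open>{x, y}\<close>.\<close>

lemma parent_unique:
  assumes x: "x \<in> V - set xs"
    and y: "{x, y} \<in> E" "depth x = Suc (depth y)"
    and y': "{x, y'} \<in> E" "depth x = Suc (depth y')"
  shows "y = y'"
proof (rule ccontr)
  assume neq: "y \<noteq> y'"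
  have e: "{x, y} \<notin> cyclic_edges xs"
    using cyc_edge_subset x by blast
  \<comment> \<open>The depth of the upper end \<open>x\<close> exceeds the bound
    \<open>depth y\<close>, which equals \<open>depth y'\<close>.\<close>
  have "{x, y} \<notin> descending_edges (depth y)"
    using y by (auto simp: descending_edges_def doubleton_eq_iff)
  then have "(y', y) \<in> (adj (E - {{x, y}}))\<^sup>*"
    using connected_by_descents[of y' y "{x, y}"] e y y' edge_V by simp
  moreover have "(x, y') \<in> adj (E - {{x, y}})"
    using y' neq by (auto simp: adj_iff doubleton_eq_iff)
  ultimately have "(x, y) \<in> (adj (E - {{x, y}}))\<^sup>*"
    by (rule converse_rtrancl_into_rtrancl[rotated])
  then show False
    using non_cycle_edge_bridge y(1) e by blast
qed

section \<open>Parents and parent edges\<close>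

definition "parent x = (THE y. {x, y} \<in> E \<and> depth x = Suc (depth y))"

definition "parent_edge x = {x, parent x}"

lemma parent_eq:
  "x \<in> V - set xs \<Longrightarrow> {x, y} \<in> E \<Longrightarrow> depth x = Suc (depth y) \<Longrightarrow> parent x = y"
  unfolding parent_def using parent_unique by (intro the_equality) blast+

lemma parent:
  assumes "x \<in> V - set xs"
  shows "{x, parent x} \<in> E" "depth x = Suc (depth (parent x))"
  using ex_parent[OF assms] parent_eq[OF assms] by blast+

text \<open>Injectivity: two vertices that are each other's parent would have contradictory depths.
  Surjectivity: the ends of an edge off the cycle differ in depth, and the deeper end has the other
  as its parent.\<close>

lemma parent_edge_bij: "bij_betw parent_edge (V - set xs) (E - cyclic_edges xs)"
  unfolding bij_betw_def
proof
  show "inj_on parent_edge (V - set xs)"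
  proof (rule inj_onI)
    fix x y
    assume x: "x \<in> V - set xs" and y: "y \<in> V - set xs" and "parent_edge x = parent_edge y"
    then consider "x = y" | "x = parent y" "parent x = y"
      unfolding parent_edge_def doubleton_eq_iff by blast
    then show "x = y"
    proof cases
      case 2
      then have "depth x = Suc (depth y)" "depth y = Suc (depth x)"
        using parent(2)[OF x] parent(2)[OF y] by simp_all
      then show ?thesis by simp
    qed
  qed
  show "parent_edge ` (V - set xs) = E - cyclic_edges xs"
  proof
    show "parent_edge ` (V - set xs) \<subseteq> E - cyclic_edges xs"
      using parent(1) cyc_edge_subset by (auto simp: parent_edge_def)
    show "E - cyclic_edges xs \<subseteq> parent_edge ` (V - set xs)"
    proof
      fix e assume e: "e \<in> E - cyclic_edges xs"
      have hit: "e \<in> parent_edge ` (V - set xs)"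
        if "e = {x, y}" "depth y < depth x" for x y
      proof -
        have "{x, y} \<in> E" using e that by blast
        then have "depth x = Suc (depth y)" "x \<in> V"
          using depth_edge[of y x] that edge_V by (auto simp: insert_commute)
        moreover then have "x \<in> V - set xs" using depth_eq_0_iff[of x] by simp
        ultimately have "parent x = y" using parent_eq \<open>{x, y} \<in> E\<close> by blast
        then show ?thesis
          using \<open>x \<in> V - set xs\<close> that by (auto simp: parent_edge_def)
      qed
      obtain x y where "e = {x, y}" using e edge_obtain by blast
      then have "depth x < depth y \<or> depth y < depth x"
        using non_cycle_edge_depth_neq[of x y] e by auto
      then show "e \<in> parent_edge ` (V - set xs)"
        using hit[of x y] hit[of y x] \<open>e = {x, y}\<close> by (auto simp: insert_commute)
    qed
  qed
qed

lemma non_cycle_edge_obtain: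
  assumes "e \<notin> cyclic_edges xs" and "e \<in> E"
  obtains x where "x \<in> V - set xs" "e = parent_edge x"
proof -
  have "e \<in> parent_edge ` (V - set xs)"
    using bij_betw_imp_surj_on[OF parent_edge_bij] assms by simp
  then show thesis using that by blast
qed

lemma automorphism_off_cycle:
  assumes "automorphism V E f" and "x \<in> V - set xs"
  shows "f x \<in> V - set xs"
  using assms depth_automorphism[OF assms(1), of x] depth_eq_0_iff[of x] depth_eq_0_iff[of "f x"]
  by (auto simp: automorphism_def dest: bij_betwE)

text \<open>Parents are characterised by adjacency and depth, and automorphisms preserve
  both.\<close>

lemma parent_edge_automorphism:
  assumes f: "automorphism V E f" and x: "x \<in> V - set xs"
  shows "parent_edge (f x) = f ` parent_edge x"
proof -
  note p = parent[OF x]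
  have V: "x \<in> V" "parent x \<in> V" using edge_V[OF p(1)] by auto
  have "parent (f x) = f (parent x)"
    using f p V depth_automorphism[OF f] automorphism_off_cycle[OF f x]
    by (intro parent_eq) (auto simp: automorphism_def)
  then show ?thesis by (simp add: parent_edge_def)
qed

section \<open>Transfer of labelings between vertices and edges\<close>

lemma cyc_edge_rotate: "\<forall>i. f (v i) = v (i + k) \<Longrightarrow> f ` cyc_edge i = cyc_edge (i + k)"
  by (simp add: cyc_edge_def algebra_simps)

lemma cyc_edge_reflect: "\<forall>i. f (v i) = v (k - i) \<Longrightarrow> f ` cyc_edge i = cyc_edge (k - 1 - i)"
  by (simp add: cyc_edge_def algebra_simps insert_commute)

text \<open>An automorphism preserving the new labeling \<open>c'\<close> preserves
  \<open>c\<close>: on the cycle by the dihedral implications for \<open>b\<close>, off it by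
  equivariance of \<open>parent_edge\<close>. Hence it is the identity on \<open>V\<close>.\<close>

lemma edge_labeling_of_vertex_labeling:
  assumes range: "c \<in> V \<rightarrow> {1..r}" and dist: "distinguishing_vertex_labeling V E c"
  shows "\<exists>c' \<in> E \<rightarrow> {1..r}. distinguishing_edge_labeling V E c'"
proof -
  have v_V: "v i \<in> V" for i using xs_V set_xs by blast
  have "\<exists>b. (\<forall>i. b (i mod n) = b i) \<and> (\<forall>i. b i \<in> {1..r}) \<and>
    (\<forall>k. (\<forall>i. b (i + k) = b i) \<longrightarrow> (\<forall>i. c (v (i + k)) = c (v i))) \<and>
    (\<forall>k. (\<forall>i. b (k - 1 - i) = b i) \<longrightarrow> (\<forall>i. c (v (k - i)) = c (v i)))"
    using length_xs range v_V by (intro vertex_to_edge_labeling) (auto simp: cyc_nth_mod)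
  then obtain b where b: "\<And>i. b (i mod n) = b i" "\<And>i. b i \<in> {1..r}"
    "\<And>k. \<forall>i. b (i + k) = b i \<Longrightarrow> \<forall>i. c (v (i + k)) = c (v i)"
    "\<And>k. \<forall>i. b (k - 1 - i) = b i \<Longrightarrow> \<forall>i. c (v (k - i)) = c (v i)"
    by blast
  \<comment> \<open>Every admissible index gives the same value, since \<open>b\<close> is periodic;
    an edge off the cycle takes the label of its deeper end.\<close>
  define c' where "c' e = (if e \<in> cyclic_edges xs then b (SOME i. e = cyc_edge i)
    else c (inv_into (V - set xs) parent_edge e))" for e
  have c'_cyc: "c' (cyc_edge i) = b i" for i
  proof -
    have "cyc_edge i = cyc_edge (SOME j. cyc_edge i = cyc_edge j)"
      by (rule someI) (rule refl)
    then have "b (SOME j. cyc_edge i = cyc_edge j) = b i"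
      using b(1) by (metis cyc_edge_eq_iff)
    then show ?thesis by (simp add: c'_def cyclic_edges_xs)
  qed
  have c'_parent: "c' (parent_edge x) = c x" if "x \<in> V - set xs" for x
    using that parent_edge_bij by (auto simp: c'_def bij_betw_def)
  have "c' \<in> E \<rightarrow> {1..r}"
  proof
    fix e assume e: "e \<in> E"
    show "c' e \<in> {1..r}"
    proof (cases "e \<in> cyclic_edges xs")
      case True
      then show ?thesis using c'_cyc b(2) by (auto simp: cyclic_edges_xs)
    next
      case False
      then obtain x where "x \<in> V - set xs" "e = parent_edge x"
        using e by (rule non_cycle_edge_obtain)
      then show ?thesis using c'_parent range by auto
    qed
  qed
  moreover have "distinguishing_edge_labeling V E c'"
    unfolding distinguishing_edge_labeling_def
  proof (intro allI impI)
    fix f assume "automorphism V E f \<and> (\<forall>e\<in>E. c' (f ` e) = c' e)"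
    then have f: "automorphism V E f" and pres: "\<And>e. e \<in> E \<Longrightarrow> c' (f ` e) = c' e"
      by auto
    have pres_cyc: "c' (f ` cyc_edge i) = b i" for i
      using pres[of "cyc_edge i"] cycle_E c'_cyc by (auto simp: cyclic_edges_xs)
    have on: "c (f (v i)) = c (v i)" for i
      using automorphism_dihedral[OF f]
    proof (elim disjE exE)
      fix k assume k: "\<forall>i. f (v i) = v (i + k)"
      then have "\<forall>i. b (i + k) = b i"
        using pres_cyc c'_cyc by (simp add: cyc_edge_rotate[OF k])
      then show ?thesis using b(3) k by simp
    next
      fix k assume k: "\<forall>i. f (v i) = v (k - i)"
      then have "\<forall>i. b (k - 1 - i) = b i"
        using pres_cyc c'_cyc by (simp add: cyc_edge_reflect[OF k])
      then show ?thesis using b(4) k by simp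
    qed
    have off: "c (f x) = c x" if x: "x \<in> V - set xs" for x
    proof -
      have "parent_edge x \<in> E" using x parent(1) by (simp add: parent_edge_def)
      then show ?thesis
        using pres[of "parent_edge x"] x c'_parent automorphism_off_cycle[OF f x]
          parent_edge_automorphism[OF f x] by metis
    qed
    have "c (f x) = c x" if "x \<in> V" for x
      using on off that set_xs by (cases "x \<in> set xs") auto
    then show "\<forall>x\<in>V. f x = x"
      using dist f unfolding distinguishing_vertex_labeling_def by blast
  qed
  ultimately show ?thesis by blast
qed

text \<open>The mirror image: a vertex off the cycle inherits the label of its parent edge, and the
  dual transfer handles the cycle.\<close>

lemma vertex_labeling_of_edge_labeling:
  assumes range: "c \<in> E \<rightarrow> {1..r}" and dist: "distinguishing_edge_labeling V E c"
  shows "\<exists>c' \<in> V \<rightarrow> {1..r}. distinguishing_vertex_labeling V E c'"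
proof -
  have cyc_E: "cyc_edge i \<in> E" for i using cycle_E cyclic_edges_xs by blast
  have "\<exists>a. (\<forall>i. a (i mod n) = a i) \<and> (\<forall>i. a i \<in> {1..r}) \<and>
    (\<forall>k. (\<forall>i. a (i + k) = a i) \<longrightarrow> (\<forall>i. c (cyc_edge (i + k)) = c (cyc_edge i))) \<and>
    (\<forall>k. (\<forall>i. a (k - i) = a i) \<longrightarrow> (\<forall>i. c (cyc_edge (k - 1 - i)) = c (cyc_edge i)))"
  proof (rule edge_to_vertex_labeling)
    have "cyc_edge (i mod n) = cyc_edge i" for i
      by (simp add: cyc_edge_eq_iff)
    then show "c (cyc_edge (i mod n)) = c (cyc_edge i)" for i by simp
  qed (use length_xs range cyc_E in auto)
  then obtain a where a: "\<And>i. a (i mod n) = a i" "\<And>i. a i \<in> {1..r}"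
    "\<And>k. \<forall>i. a (i + k) = a i \<Longrightarrow> \<forall>i. c (cyc_edge (i + k)) = c (cyc_edge i)"
    "\<And>k. \<forall>i. a (k - i) = a i \<Longrightarrow> \<forall>i. c (cyc_edge (k - 1 - i)) = c (cyc_edge i)"
    by blast
  define c' where "c' x = (if x \<in> set xs then a (SOME i. x = v i) else c (parent_edge x))" for x
  have c'_cyc: "c' (v i) = a i" for i
  proof -
    have "v i = v (SOME j. v i = v j)"
      by (rule someI) (rule refl)
    then have "a (SOME j. v i = v j) = a i"
      using a(1) by (metis v_eq_iff)
    then show ?thesis by (simp add: c'_def set_xs)
  qed
  have c'_parent: "c' x = c (parent_edge x)" if "x \<in> V - set xs" for x
    using that by (simp add: c'_def)
  have "c' \<in> V \<rightarrow> {1..r}"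
  proof
    fix x assume x: "x \<in> V"
    show "c' x \<in> {1..r}"
    proof (cases "x \<in> set xs")
      case True
      then show ?thesis using c'_cyc a(2) by (auto simp: set_xs)
    next
      case False
      then have "parent_edge x \<in> E" using x parent(1) by (simp add: parent_edge_def)
      then show ?thesis using False range by (auto simp: c'_def)
    qed
  qed
  moreover have "distinguishing_vertex_labeling V E c'"
    unfolding distinguishing_vertex_labeling_def
  proof (intro allI impI)
    fix f assume "automorphism V E f \<and> (\<forall>x\<in>V. c' (f x) = c' x)"
    then have f: "automorphism V E f" and pres: "\<And>x. x \<in> V \<Longrightarrow> c' (f x) = c' x"
      by auto
    have pres_cyc: "c' (f (v i)) = a i" for i
      using pres[of "v i"] xs_V c'_cyc by (auto simp: set_xs)
    have on: "c (f ` cyc_edge i) = c (cyc_edge i)" for i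
      using automorphism_dihedral[OF f]
    proof (elim disjE exE)
      fix k assume k: "\<forall>i. f (v i) = v (i + k)"
      then have "\<forall>i. a (i + k) = a i"
        using pres_cyc c'_cyc by simp
      then show ?thesis using a(3) k by (simp add: cyc_edge_rotate[OF k])
    next
      fix k assume k: "\<forall>i. f (v i) = v (k - i)"
      then have "\<forall>i. a (k - i) = a i"
        using pres_cyc c'_cyc by simp
      then show ?thesis using a(4) k by (simp add: cyc_edge_reflect[OF k])
    qed
    have off: "c (f ` parent_edge x) = c (parent_edge x)" if x: "x \<in> V - set xs" for x
      using pres[of x] x c'_parent automorphism_off_cycle[OF f x]
        parent_edge_automorphism[OF f x] by auto
    have "c (f ` e) = c e" if e: "e \<in> E" for e
    proof (cases "e \<in> cyclic_edges xs")
      case True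
      then show ?thesis using on by (auto simp: cyclic_edges_xs)
    next
      case False
      then obtain x where "x \<in> V - set xs" "e = parent_edge x"
        using e by (rule non_cycle_edge_obtain)
      then show ?thesis using off by simp
    qed
    then show "\<forall>x\<in>V. f x = x"
      using dist f unfolding distinguishing_edge_labeling_def by blast
  qed
  ultimately show ?thesis by blast
qed

text \<open>Both transfers keep the label range \<open>{1..r}\<close>, so the two
  \<open>LEAST\<close> terms minimise equivalent predicates.\<close>

lemma distinguishing_index_eq_number: "distinguishing_index V E = distinguishing_number V E"
proof -
  have "(\<exists>c \<in> E \<rightarrow> {1..r}. distinguishing_edge_labeling V E c) \<longleftrightarrow>
      (\<exists>c \<in> V \<rightarrow> {1..r}. distinguishing_vertex_labeling V E c)" for r
    using edge_labeling_of_vertex_labeling vertex_labeling_of_edge_labeling by meson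
  then show ?thesis
    by (simp add: distinguishing_index_def distinguishing_number_def)
qed

end

theorem theorem2:
  fixes V :: "'a set" and E :: "'a set set"
  assumes "finite_simple_graph V E"
    and "connected_graph V E"
    and "unicyclic V E"
  shows "distinguishing_index V E = distinguishing_number V E"
proof -
  obtain C where C: "is_cycle V E C" "\<And>C'. is_cycle V E C' \<Longrightarrow> C' = C"
    using assms(3) by (auto simp: unicyclic_def)
  then obtain xs where xs: "3 \<le> length xs" "distinct xs" "set xs \<subseteq> V"
      "C = cyclic_edges xs" "C \<subseteq> E"
    unfolding is_cycle_def by blast
  \<comment> \<open>Any vertex sequence of the unique cycle may serve as \<open>xs\<close>.\<close>
  interpret unicyclic_graph V E xs
    by unfold_locales (use assms xs C(2) in simp_all)
  show ?thesis by (rule distinguishing_index_eq_number)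
qed

end
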